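(* Let $\mathcal{X}$ be an infinite-dimensional real Banach space and let $\mathcal{A}\subset\mathcal{B}(\mathcal{X})$ be an $L$-algebra. If $\mathcal{A}$ is of real type, then $\mathcal{A}$ is dense; if $\mathcal{A}$ is of complex type, then $\mathcal{A}$ is $(1/2)$-dense; if $\mathcal{A}$ is of quaternion type, then $\mathcal{A}$ is $(1/4)$-dense.
   Context: $\mathcal{B}(\mathcal{X})$ denotes the algebra of all bounded linear operators on $\mathcal{X}$. An algebra of operators on $\mathcal{X}$ is a (real) subalgebra of $\mathcal{B}(\mathcal{X})$, not assumed unital or closed. It is transitive if for any $\varepsilon>0$ and any $x,y\in\mathcal{X}$ with $x\neq 0$ there is $T\in\mathcal{A}$ with $\|Tx-y\|<\varepsilon$ (equivalently, it has no non-trivial closed invariant subspaces). An $L$-algebra is a transitive algebra of operators on $\mathcal{X}$ that contains a non-zero finite rank operator. For an $L$-algebra $\mathcal{A}$, $\mathcal{A}^F$ is the set of all finite rank operators in $\mathcal{A}$, and $\mathcal{X}^F=\mathrm{lin}\{Tx: T\in\mathcal{A}^F, x\in\mathcal{X}\}$ (a dense $\mathcal{A}$-invariant linear subspace). $\mathbb{D}$ is the algebra of all linear operators $\mathcal{X}^F\to\mathcal{X}^F$ (not assumed bounded) commuting with the restrictions to $\mathcal{X}^F$ of all operators in $\mathcal{A}^F$; it is always a finite-dimensional real division algebra, hence isomorphic to $\mathbb{R}$, $\mathbb{C}$ or the quaternions $\mathbb{H}$. $\mathcal{A}$ is of real, complex or quaternion type if $\mathbb{D}$ is isomorphic to $\mathbb{R}$,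 $\mathbb{C}$ or $\mathbb{H}$, respectively. An algebra $\mathcal{A}$ is dense if for any $\varepsilon>0$, each finite linearly independent family $(x_1,\dots,x_n)\subset\mathcal{X}$ and any family $(y_1,\dots,y_n)\subset\mathcal{X}$ there is $T\in\mathcal{A}$ with $\|Tx_i-y_i\|<\varepsilon$, $i=1,\dots,n$. For $k\in\mathbb{N}$, $\mathcal{A}$ is $(1/k)$-dense if for any $\varepsilon>0$, any $n\ge1$, every linearly independent family $(x_1,\dots,x_{kn})\subset\mathcal{X}$ and any family $(y_1,\dots,y_n)\subset\mathcal{X}$, there are $j_1,\dots,j_n\in\{1,\dots,kn\}$ and $T\in\mathcal{A}$ with $\|y_i-Tx_{j_i}\|<\varepsilon$ for $1\le i\le n$. *)

theory Defs
  imports "HOL-Analysis.Analysis"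
begin

section \<open>The real algebra of quaternions\<close>

text \<open>\<open>Quat a b c d\<close> stands for $a + bi + cj + dk$, where
  $i^2 = j^2 = k^2 = -1$, $ij = k = -ji$, $jk = i = -kj$, $ki = j = -ik$.\<close>

datatype quat = Quat (qre: real) (qi: real) (qj: real) (qk: real)

lemma quat_eq_iff: "p = q \<longleftrightarrow> qre p = qre q \<and> qi p = qi q \<and> qj p = qj q \<and> qk p = qk q"
  by (auto intro: quat.expand)

instantiation quat :: real_algebra_1
begin

definition zero_quat :: quat where
  "0 = Quat 0 0 0 0"

definition one_quat :: quat where
  "1 = Quat 1 0 0 0"

definition plus_quat :: "quat \<Rightarrow> quat \<Rightarrow> quat" where
  "p + q = Quat (qre p + qre q) (qi p + qi q) (qj p + qj q) (qk p + qk q)"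

definition uminus_quat :: "quat \<Rightarrow> quat" where
  "- p = Quat (- qre p) (- qi p) (- qj p) (- qk p)"

definition minus_quat :: "quat \<Rightarrow> quat \<Rightarrow> quat" where
  "p - q = Quat (qre p - qre q) (qi p - qi q) (qj p - qj q) (qk p - qk q)"

definition scaleR_quat :: "real \<Rightarrow> quat \<Rightarrow> quat" where
  "r *\<^sub>R p = Quat (r * qre p) (r * qi p) (r * qj p) (r * qk p)"

definition times_quat :: "quat \<Rightarrow> quat \<Rightarrow> quat" where
  "p * q = Quat
     (qre p * qre q - qi p * qi q - qj p * qj q - qk p * qk q)
     (qre p * qi q + qi p * qre q + qj p * qk q - qk p * qj q)
     (qre p * qj q - qi p * qk q + qj p * qre q + qk p * qi q)
     (qre p * qk q + qi p * qj q - qj p * qi q + qk p * qre q)"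

instance
  by standard
    (simp_all add: quat_eq_iff zero_quat_def one_quat_def plus_quat_def uminus_quat_def
      minus_quat_def scaleR_quat_def times_quat_def algebra_simps)

end

lemma quat_unit_products:
  defines "i \<equiv> Quat 0 1 0 0" and "j \<equiv> Quat 0 0 1 0" and "k \<equiv> Quat 0 0 0 1"
  shows "i * i = - 1" "j * j = - 1" "k * k = - 1"
    "i * j = k" "j * i = - k" "j * k = i" "k * j = - i" "k * i = j" "i * k = - j"
  by (simp_all add: i_def j_def k_def quat_eq_iff one_quat_def uminus_quat_def times_quat_def)


section \<open>Algebras of operators\<close>

definition operator_algebra :: "('a::real_normed_vector \<Rightarrow>\<^sub>L 'a) set \<Rightarrow> bool" where
  "operator_algebra A \<longleftrightarrow> subspace A \<and> (\<forall>S\<in>A. \<forall>T\<in>A. S o\<^sub>L T \<in> A)"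

definition transitive_algebra :: "('a::real_normed_vector \<Rightarrow>\<^sub>L 'a) set \<Rightarrow> bool" where
  "transitive_algebra A \<longleftrightarrow> operator_algebra A \<and>
     (\<forall>\<epsilon>>0. \<forall>x y. x \<noteq> 0 \<longrightarrow> (\<exists>T\<in>A. norm (blinfun_apply T x - y) < \<epsilon>))"

definition finite_rank :: "('a::real_normed_vector \<Rightarrow>\<^sub>L 'a) \<Rightarrow> bool" where
  "finite_rank T \<longleftrightarrow> (\<exists>B. finite B \<and> range (blinfun_apply T) \<subseteq> span B)"

definition L_algebra :: "('a::real_normed_vector \<Rightarrow>\<^sub>L 'a) set \<Rightarrow> bool" where
  "L_algebra A \<longleftrightarrow> transitive_algebra A \<and> (\<exists>T\<in>A. T \<noteq> 0 \<and> finite_rank T)"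

definition finite_rank_part ::
    "('a::real_normed_vector \<Rightarrow>\<^sub>L 'a) set \<Rightarrow> ('a \<Rightarrow>\<^sub>L 'a) set" where
  "finite_rank_part A = {T \<in> A. finite_rank T}"

definition finite_rank_space :: "('a::real_normed_vector \<Rightarrow>\<^sub>L 'a) set \<Rightarrow> 'a set" where
  "finite_rank_space A = span {blinfun_apply T x | T x. T \<in> finite_rank_part A}"


section \<open>The type of an L-algebra\<close>

text \<open>A linear operator on the subspace \<open>finite_rank_space A\<close>, not assumed bounded, is
  represented by an extensional function (\<open>undefined\<close> off the subspace), so that
  equal operators are equal functions.\<close>

definition commuting_operators :: "('a::real_normed_vector \<Rightarrow>\<^sub>L 'a) set \<Rightarrow> ('a \<Rightarrow> 'a) set" where
  "commuting_operators A = (let V = finite_rank_space A in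
     {S \<in> V \<rightarrow>\<^sub>E V.
        (\<forall>x\<in>V. \<forall>y\<in>V. S (x + y) = S x + S y) \<and>
        (\<forall>c. \<forall>x\<in>V. S (c *\<^sub>R x) = c *\<^sub>R S x) \<and>
        (\<forall>T\<in>finite_rank_part A. \<forall>x\<in>V. S (blinfun_apply T x) = blinfun_apply T (S x))})"

text \<open>\<open>f\<close> is an isomorphism of real algebras from \<open>'k\<close> onto \<open>commuting_operators A\<close>, the latter
  with pointwise linear structure and composition as product.  As \<open>f\<close> is
  onto and the identity of the subspace commutes, \<open>f 1\<close> is that identity.\<close>

definition commuting_operators_iso ::
    "('k::real_algebra_1 \<Rightarrow> 'a \<Rightarrow> 'a) \<Rightarrow> ('a::real_normed_vector \<Rightarrow>\<^sub>L 'a) set \<Rightarrow> bool" where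
  "commuting_operators_iso f A \<longleftrightarrow> (let V = finite_rank_space A in
     bij_betw f UNIV (commuting_operators A) \<and>
     (\<forall>a b. \<forall>x\<in>V. f (a + b) x = f a x + f b x) \<and>
     (\<forall>c a. \<forall>x\<in>V. f (c *\<^sub>R a) x = c *\<^sub>R f a x) \<and>
     (\<forall>a b. \<forall>x\<in>V. f (a * b) x = f a (f b x)))"

definition real_type :: "('a::real_normed_vector \<Rightarrow>\<^sub>L 'a) set \<Rightarrow> bool" where
  "real_type A \<longleftrightarrow> (\<exists>f :: real \<Rightarrow> 'a \<Rightarrow> 'a. commuting_operators_iso f A)"

definition complex_type :: "('a::real_normed_vector \<Rightarrow>\<^sub>L 'a) set \<Rightarrow> bool" where
  "complex_type A \<longleftrightarrow> (\<exists>f :: complex \<Rightarrow> 'a \<Rightarrow> 'a. commuting_operators_iso f A)"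

definition quaternion_type :: "('a::real_normed_vector \<Rightarrow>\<^sub>L 'a) set \<Rightarrow> bool" where
  "quaternion_type A \<longleftrightarrow> (\<exists>f :: quat \<Rightarrow> 'a \<Rightarrow> 'a. commuting_operators_iso f A)"


section \<open>Density\<close>

definition independent_family :: "nat \<Rightarrow> (nat \<Rightarrow> 'a::real_vector) \<Rightarrow> bool" where
  "independent_family m x \<longleftrightarrow> inj_on x {1..m} \<and> independent (x ` {1..m})"

definition dense_algebra :: "('a::real_normed_vector \<Rightarrow>\<^sub>L 'a) set \<Rightarrow> bool" where
  "dense_algebra A \<longleftrightarrow>
     (\<forall>\<epsilon>>0. \<forall>n. \<forall>x y :: nat \<Rightarrow> 'a. independent_family n x \<longrightarrow>
       (\<exists>T\<in>A. \<forall>i\<in>{1..n}. norm (blinfun_apply T (x i) - y i) < \<epsilon>))"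

text \<open>\<open>fraction_dense k A\<close> says that \<open>A\<close> is $(1/k)$-dense, for \<open>k \<ge> 1\<close>.\<close>

definition fraction_dense :: "nat \<Rightarrow> ('a::real_normed_vector \<Rightarrow>\<^sub>L 'a) set \<Rightarrow> bool" where
  "fraction_dense k A \<longleftrightarrow>
     (\<forall>\<epsilon>>0. \<forall>n\<ge>1. \<forall>x y :: nat \<Rightarrow> 'a. independent_family (k * n) x \<longrightarrow>
       (\<exists>j. (\<forall>i\<in>{1..n}. j i \<in> {1..k * n}) \<and>
         (\<exists>T\<in>A. \<forall>i\<in>{1..n}. norm (y i - blinfun_apply T (x (j i))) < \<epsilon>)))"

end

theory Submission
  imports Defs
begin

text \<open>Write \<open>F\<close> for the ideal of finite rank operators of \<open>A\<close> and \<open>V\<close> for the linear span of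
  their ranges.  Everything rests on the fact that \<open>F\<close> moves \<^emph>\<open>every\<close> non-zero vector of the whole
  space, not only of \<open>V\<close>, onto exactly \<open>V\<close> (lemma \<open>finite_rank_orbit\<close>): the orbit \<open>A x\<close> is dense,
  so \<open>T A x\<close> is dense in the range of \<open>T \<in> F\<close>, and a dense subspace of a
  finite-dimensional space is everything.

  In particular \<open>V\<close> is a simple \<open>F\<close>-module, and Jacobson's density argument applies, even to
  vectors outside \<open>V\<close>.  Call a finite family \<open>x\<close> free if operators in \<open>F\<close> can send its members to
  arbitrary prescribed elements of \<open>V\<close>.  If \<open>x\<close> is free and adding a vector \<open>z\<close> destroys freeness,
  then \<open>T z = (\<Sum>j. S\<^sub>j (T x\<^sub>j))\<close> for all \<open>T \<in> F\<close>, with coefficients \<open>S\<^sub>j\<close> in the commutant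
  (\<open>free_family_insert\<close> and \<open>commutant_combination\<close>).

  The rest is dimension counting.  Suppose the commutant is the image of a real algebra of
  dimension \<open>k\<close>, and let \<open>J\<close> index a maximal free subfamily of \<open>m\<close> linearly independent vectors.
  Each of the \<open>m\<close> vectors is described by \<open>card J\<close> coefficients in the commutant, that is by
  \<open>k * card J\<close> real numbers.  If \<open>m > k * card J\<close>, some non-trivial real combination \<open>z\<close> of the
  vectors has all its coefficients zero, so \<open>T z = 0\<close> for all \<open>T \<in> F\<close>, which forces \<open>z = 0\<close> against
  independence.  Hence \<open>m \<le> k * card J\<close> (\<open>large_free_subfamily\<close>): among \<open>k * n\<close> independent
  vectors there are \<open>n\<close> that form a free family.  As \<open>V\<close> is dense, operators in \<open>F\<close> move these \<open>n\<close>
  vectors as close as desired to arbitrary targets.  For \<open>k = 1\<close> the free subfamily is the whole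
  family, which gives density.\<close>

section \<open>Two facts from linear algebra\<close>

text \<open>Induction on the number of generators.  For \<open>b\<close> outside a closed subspace, the coefficient of
  \<open>b\<close> is controlled by the norm of the sum because \<open>b\<close> has positive distance from the subspace; so
  the coefficients along a convergent sequence converge too.\<close>

lemma closed_span_finite:
  fixes B :: "'a::real_normed_vector set"
  assumes "finite B"
  shows "closed (span B)"
  using assms
proof induction
  case empty
  then show ?case by simp
next
  case (insert b B)
  show ?case
  proof (cases "b \<in> span B")
    case True
    then show ?thesis using insert.IH by (simp add: span_redundant)
  next
    case False
    then obtain e where e: "e > 0" and ball: "ball b e \<subseteq> - span B"
      using insert.IH by (metis ComplI open_Compl openE)
    have control: "\<bar>c\<bar> * e \<le> norm (c *\<^sub>R b + m)" if m: "m \<in> span B" for c m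
    proof (cases "c = 0")
      case False
      have "- (1 / c) *\<^sub>R m \<in> span B" using m by (rule span_scale)
      then have "e \<le> dist b (- (1 / c) *\<^sub>R m)"
        using ball by (meson ComplD in_mono mem_ball not_le)
      then have "\<bar>c\<bar> * e \<le> norm (c *\<^sub>R (b - (- (1 / c) *\<^sub>R m)))"
        by (simp only: dist_norm norm_scaleR mult_left_mono abs_ge_zero)
      also have "c *\<^sub>R (b - (- (1 / c) *\<^sub>R m)) = c *\<^sub>R b + m"
        using False by (simp add: algebra_simps)
      finally show ?thesis .
    qed simp
    show ?thesis
      unfolding closed_sequential_limits
    proof (intro allI impI, elim conjE)
      fix z l
      assume z: "\<forall>n. z n \<in> span (insert b B)" and lim: "z \<longlonglongrightarrow> l"
      have "\<exists>c. z n - c *\<^sub>R b \<in> span B" for n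
        using z by (simp add: span_breakdown_eq)
      then obtain c where c: "\<And>n. z n - c n *\<^sub>R b \<in> span B" by metis
      have "Cauchy c"
      proof (rule metric_CauchyI)
        fix r :: real
        assume "r > 0"
        then have "r * e > 0" using e by simp
        then obtain M where M: "\<And>p q. p \<ge> M \<Longrightarrow> q \<ge> M \<Longrightarrow> dist (z p) (z q) < r * e"
          using metric_CauchyD[OF LIMSEQ_imp_Cauchy[OF lim]] by blast
        have "dist (c p) (c q) < r" if "p \<ge> M" "q \<ge> M" for p q
        proof -
          have "\<bar>c p - c q\<bar> * e
              \<le> norm ((c p - c q) *\<^sub>R b + ((z p - c p *\<^sub>R b) - (z q - c q *\<^sub>R b)))"
            by (rule control) (intro span_diff c)
          also have "\<dots> = dist (z p) (z q)"
            by (simp add: dist_norm algebra_simps)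
          finally have "\<bar>c p - c q\<bar> * e < r * e" using M[OF that] by simp
          then show ?thesis using e by (simp add: dist_real_def)
        qed
        then show "\<exists>M. \<forall>p\<ge>M. \<forall>q\<ge>M. dist (c p) (c q) < r" by blast
      qed
      then obtain c' where "c \<longlonglongrightarrow> c'"
        using Cauchy_convergent convergent_def by blast
      then have "(\<lambda>n. z n - c n *\<^sub>R b) \<longlonglongrightarrow> l - c' *\<^sub>R b"
        using lim by (intro tendsto_intros)
      then have "l - c' *\<^sub>R b \<in> span B"
        using closed_sequentially[OF insert.IH, of "\<lambda>n. z n - c n *\<^sub>R b"] c by blast
      then show "l \<in> span (insert b B)"
        by (auto simp: span_breakdown_eq)
    qed
  qed
qed

text \<open>Gaussian elimination: an equation with a non-zero coefficient at \<open>p\<close> is used to eliminate the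
  unknown \<open>p\<close> from the remaining equations.\<close>

lemma nontrivial_solution_homogeneous_system:
  fixes m :: "'i \<Rightarrow> 'e \<Rightarrow> real"
  assumes "finite E" "finite I" "card E < card I"
  shows "\<exists>c. (\<exists>i\<in>I. c i \<noteq> 0) \<and> (\<forall>e\<in>E. (\<Sum>i\<in>I. c i * m i e) = 0)"
  using assms
proof (induction E arbitrary: I m)
  case empty
  then obtain i where "i \<in> I" by fastforce
  then show ?case by (intro exI[of _ "\<lambda>_. 1"]) auto
next
  case (insert e E)
  show ?case
  proof (cases "\<forall>i\<in>I. m i e = 0")
    case True
    obtain c where "\<exists>i\<in>I. c i \<noteq> 0" "\<forall>e\<in>E. (\<Sum>i\<in>I. c i * m i e) = 0"
      using insert.IH[of I m] insert.prems insert.hyps by auto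
    then show ?thesis using True by (intro exI[of _ c]) auto
  next
    case False
    then obtain p where p: "p \<in> I" "m p e \<noteq> 0" by blast
    define I' where "I' = I - {p}"
    have I': "finite I'" "p \<notin> I'" "I = insert p I'" "card E < card I'"
      using p insert.prems insert.hyps by (auto simp: I'_def card_Diff_singleton)
    obtain c where c: "\<exists>i\<in>I'. c i \<noteq> 0"
      and sol: "\<forall>e'\<in>E. (\<Sum>i\<in>I'. c i * (m i e' - m i e / m p e * m p e')) = 0"
      using insert.IH[OF I'(1,4), of "\<lambda>i e'. m i e' - m i e / m p e * m p e'"] by blast
    define d where "d = c(p := - (\<Sum>i\<in>I'. c i * m i e) / m p e)"
    have sum_d: "(\<Sum>i\<in>I. d i * m i e')
        = (\<Sum>i\<in>I'. c i * m i e') - (\<Sum>i\<in>I'. c i * m i e) / m p e * m p e'" for e'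
    proof -
      have "(\<Sum>i\<in>I'. d i * m i e') = (\<Sum>i\<in>I'. c i * m i e')"
        using I'(2) by (intro sum.cong) (auto simp: d_def)
      then show ?thesis using I' by (simp add: d_def)
    qed
    have "(\<Sum>i\<in>I. d i * m i e') = 0" if "e' \<in> insert e E" for e'
    proof (cases "e' = e")
      case True
      then show ?thesis using p sum_d[of e] by simp
    next
      case False
      then have "(\<Sum>i\<in>I'. c i * (m i e' - m i e / m p e * m p e')) = 0"
        using sol that by blast
      moreover have "(\<Sum>i\<in>I'. c i * (m i e' - m i e / m p e * m p e')) = (\<Sum>i\<in>I. d i * m i e')"
        by (simp add: sum_d right_diff_distrib sum_subtractf sum_divide_distrib sum_distrib_right
            mult.assoc)
      ultimately show ?thesis by simp
    qed
    moreover have "\<exists>i\<in>I. d i \<noteq> 0"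
      using c I'(2,3) by (auto simp: d_def)
    ultimately show ?thesis by blast
  qed
qed

lemma independent_family_coeff_zero:
  assumes "independent_family n x" "(\<Sum>i\<in>{1..n}. c i *\<^sub>R x i) = 0" "i \<in> {1..n}"
  shows "c i = 0"
proof -
  have inj: "inj_on x {1..n}" and indep: "independent (x ` {1..n})"
    using assms(1) by (auto simp: independent_family_def)
  have "(\<Sum>v\<in>x ` {1..n}. c (the_inv_into {1..n} x v) *\<^sub>R v) = (\<Sum>i\<in>{1..n}. c i *\<^sub>R x i)"
    unfolding sum.reindex[OF inj] o_def
    by (intro sum.cong refl) (simp only: the_inv_into_f_f[OF inj])
  then have "c (the_inv_into {1..n} x (x i)) = 0"
    using indep assms(2,3) by (intro independentD[where t = "x ` {1..n}"]) auto
  then show ?thesis using inj assms(3) by (simp add: the_inv_into_f_f)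
qed


section \<open>The ideal of finite rank operators\<close>

lemma finite_rank_add:
  assumes "finite_rank S" "finite_rank T"
  shows "finite_rank (S + T)"
proof -
  obtain B C where B: "finite B" "range (blinfun_apply S) \<subseteq> span B"
    and C: "finite C" "range (blinfun_apply T) \<subseteq> span C"
    using assms unfolding finite_rank_def by blast
  have "blinfun_apply S x + blinfun_apply T x \<in> span (B \<union> C)" for x
    using B(2) C(2) span_mono[of B "B \<union> C"] span_mono[of C "B \<union> C"]
    by (intro span_add) blast+
  then have "range (blinfun_apply (S + T)) \<subseteq> span (B \<union> C)"
    by (auto simp: blinfun.add_left)
  then show ?thesis
    unfolding finite_rank_def using B(1) C(1) by (meson finite_UnI)
qed

lemma finite_rank_scaleR:
  assumes "finite_rank T"
  shows "finite_rank (c *\<^sub>R T)"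
proof -
  obtain B where B: "finite B" "range (blinfun_apply T) \<subseteq> span B"
    using assms unfolding finite_rank_def by blast
  then have "range (blinfun_apply (c *\<^sub>R T)) \<subseteq> span B"
    by (auto simp: blinfun.scaleR_left image_subset_iff span_scale)
  then show ?thesis using B(1) unfolding finite_rank_def by blast
qed

lemma finite_rank_compose_right:
  assumes "finite_rank T"
  shows "finite_rank (T o\<^sub>L S)"
proof -
  have "range (blinfun_apply (T o\<^sub>L S)) \<subseteq> range (blinfun_apply T)" by auto
  then show ?thesis using assms unfolding finite_rank_def by (meson subset_trans)
qed

lemma finite_rank_compose_left:
  assumes "finite_rank T"
  shows "finite_rank (S o\<^sub>L T)"
proof -
  obtain B where B: "finite B" "range (blinfun_apply T) \<subseteq> span B"
    using assms unfolding finite_rank_def by blast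
  have "linear (blinfun_apply S)"
    by (simp add: blinfun.bounded_linear_right bounded_linear.linear)
  then have "span (blinfun_apply S ` B) = blinfun_apply S ` span B"
    by (rule linear_span_image)
  then have "range (blinfun_apply (S o\<^sub>L T)) \<subseteq> span (blinfun_apply S ` B)"
    using B(2) by auto
  then show ?thesis
    unfolding finite_rank_def using B(1) by (meson finite_imageI)
qed

lemma subspace_finite_rank_part:
  assumes "L_algebra A"
  shows "subspace (finite_rank_part A)"
proof -
  have A: "subspace A"
    using assms by (simp add: L_algebra_def transitive_algebra_def operator_algebra_def)
  have "finite_rank 0"
    unfolding finite_rank_def by (intro exI[of _ "{}"]) auto
  then show ?thesis
    using A by (auto simp: subspace_def finite_rank_part_def finite_rank_add finite_rank_scaleR)
qed

lemma finite_rank_part_ideal: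
  assumes "L_algebra A" "S \<in> A" "T \<in> finite_rank_part A"
  shows "S o\<^sub>L T \<in> finite_rank_part A" "T o\<^sub>L S \<in> finite_rank_part A"
  using assms
  by (auto simp: L_algebra_def transitive_algebra_def operator_algebra_def finite_rank_part_def
      finite_rank_compose_left finite_rank_compose_right)

lemma finite_rank_part_subset: "finite_rank_part A \<subseteq> A"
  by (auto simp: finite_rank_part_def)

lemma apply_in_finite_rank_space:
  "T \<in> finite_rank_part A \<Longrightarrow> blinfun_apply T x \<in> finite_rank_space A"
  by (auto simp: finite_rank_space_def intro: span_base)

lemma subspace_finite_rank_space: "subspace (finite_rank_space A)"
  by (simp add: finite_rank_space_def)

lemma finite_rank_space_nonzero:
  assumes "L_algebra A"
  obtains v where "v \<in> finite_rank_space A" "v \<noteq> 0"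
proof -
  obtain T where T: "T \<in> finite_rank_part A" "T \<noteq> 0"
    using assms by (auto simp: L_algebra_def finite_rank_part_def)
  then obtain x where "blinfun_apply T x \<noteq> 0"
    by (metis blinfun_eqI zero_blinfun.rep_eq)
  then show ?thesis using that apply_in_finite_rank_space T(1) by blast
qed

text \<open>For \<open>T \<in> F\<close> the subspace \<open>T A x\<close> is finite-dimensional, hence closed, and by transitivity it is
  dense in the range of \<open>T\<close>; so it is the whole range.  As \<open>T A \<subseteq> F\<close>, the orbit \<open>F x\<close>, which is
  a subspace, contains the ranges that span \<open>V\<close>.\<close>

lemma finite_rank_orbit:
  assumes L: "L_algebra A" and x: "x \<noteq> 0" and v: "v \<in> finite_rank_space A"
  obtains T where "T \<in> finite_rank_part A" "blinfun_apply T x = v"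
proof -
  let ?orbit = "(\<lambda>T. blinfun_apply T x) ` finite_rank_part A"
  have lin: "linear (\<lambda>T. blinfun_apply T x)"
    by (simp add: blinfun.bounded_linear_left bounded_linear.linear)
  have A: "subspace A"
    and dense: "\<And>\<epsilon> y. \<epsilon> > 0 \<Longrightarrow> \<exists>S\<in>A. norm (blinfun_apply S x - y) < \<epsilon>"
    using L x by (auto simp: L_algebra_def transitive_algebra_def operator_algebra_def)
  have range: "blinfun_apply T w \<in> ?orbit" if T: "T \<in> finite_rank_part A" for T w
  proof -
    let ?M = "(\<lambda>S. blinfun_apply T (blinfun_apply S x)) ` A"
    obtain B where B: "finite B" "range (blinfun_apply T) \<subseteq> span B"
      using T by (auto simp: finite_rank_part_def finite_rank_def)
    have linT: "linear (\<lambda>S. blinfun_apply T (blinfun_apply S x))"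
      by (intro linearI) (simp_all add: blinfun.bilinear_simps)
    have subM: "subspace ?M"
      using linT A by (rule linear_subspace_image)
    obtain C where C: "C \<subseteq> ?M" "independent C" "?M \<subseteq> span C"
      using maximal_independent_subset[of ?M] by blast
    have "C \<subseteq> span B" using C(1) B(2) by auto
    then have "finite C"
      using independent_span_bound[OF B(1) C(2)] by blast
    moreover have "span C = ?M"
      using C subM by (metis span_subspace)
    ultimately have "closed ?M"
      using closed_span_finite by metis
    moreover have "blinfun_apply T w \<in> closure ?M"
    proof -
      have "w \<in> closure ((\<lambda>S. blinfun_apply S x) ` A)"
        unfolding closure_approachable using dense by (auto simp: dist_norm)
      then have "blinfun_apply T w \<in> closure (blinfun_apply T ` (\<lambda>S. blinfun_apply S x) ` A)"
        using image_closure_subset[OF _ closed_closure closure_subset,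
            of "(\<lambda>S. blinfun_apply S x) ` A" "blinfun_apply T"]
        by (auto simp: linear_continuous_on blinfun.bounded_linear_right)
      then show ?thesis by (simp add: image_image)
    qed
    ultimately have "blinfun_apply T w \<in> ?M" by simp
    then obtain S where "S \<in> A" "blinfun_apply T w = blinfun_apply (T o\<^sub>L S) x"
      by auto
    then show ?thesis using finite_rank_part_ideal(2)[OF L _ T] by blast
  qed
  have "subspace ?orbit"
    using lin subspace_finite_rank_part[OF L] by (rule linear_subspace_image)
  then have "finite_rank_space A \<subseteq> ?orbit"
    unfolding finite_rank_space_def using range by (intro span_minimal) auto
  then show ?thesis using v that by blast
qed

text \<open>A non-zero \<open>v \<in> V\<close> has the form \<open>T v\<close> with \<open>T \<in> F\<close>, so its dense orbit \<open>A v = A T v\<close> stays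
  inside \<open>V\<close>.\<close>

lemma finite_rank_space_approx:
  fixes y :: "'a::real_normed_vector"
  assumes L: "L_algebra A" and "\<epsilon> > 0"
  shows "\<exists>v\<in>finite_rank_space A. norm (v - y) < \<epsilon>"
proof -
  obtain v where v: "v \<in> finite_rank_space A" "v \<noteq> 0"
    using finite_rank_space_nonzero[OF L] .
  obtain T where T: "T \<in> finite_rank_part A" "blinfun_apply T v = v"
    using finite_rank_orbit[OF L v(2,1)] .
  obtain S where S: "S \<in> A" "norm (blinfun_apply S v - y) < \<epsilon>"
    using L v(2) assms(2) unfolding L_algebra_def transitive_algebra_def by metis
  have "blinfun_apply (S o\<^sub>L T) v \<in> finite_rank_space A"
    using finite_rank_part_ideal(1)[OF L S(1) T(1)] by (rule apply_in_finite_rank_space)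
  then show ?thesis using S(2) T(2) by auto
qed


section \<open>Free families and the commutant\<close>

text \<open>Over the commutant, a division algebra by Schur's lemma, this is linear independence of the
  homomorphisms \<open>T \<mapsto> T x\<^sub>j\<close> from \<open>F\<close> to \<open>V\<close>.  Interpolation is taken as the definition because it
  is the form in which density uses it.\<close>

definition free_family ::
    "('a::real_normed_vector \<Rightarrow>\<^sub>L 'a) set \<Rightarrow> 'i set \<Rightarrow> ('i \<Rightarrow> 'a) \<Rightarrow> bool" where
  "free_family A J x \<longleftrightarrow>
     (\<forall>y. (\<forall>j\<in>J. y j \<in> finite_rank_space A) \<longrightarrow>
       (\<exists>T\<in>finite_rank_part A. \<forall>j\<in>J. blinfun_apply T (x j) = y j))"

lemma free_familyE:
  assumes "free_family A J x" "\<And>j. j \<in> J \<Longrightarrow> y j \<in> finite_rank_space A"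
  obtains T where "T \<in> finite_rank_part A" "\<And>j. j \<in> J \<Longrightarrow> blinfun_apply T (x j) = y j"
  using assms unfolding free_family_def by metis

text \<open>An operator killing the family but not the new vector can be followed by another one to
  correct the value at the new vector at will, without disturbing the values at the family.\<close>

lemma free_family_insert:
  assumes L: "L_algebra A" and free: "free_family A J x"
    and T0: "T0 \<in> finite_rank_part A" "\<And>j. j \<in> J \<Longrightarrow> blinfun_apply T0 (x j) = 0"
      "blinfun_apply T0 (x i) \<noteq> 0"
  shows "free_family A (insert i J) x"
  unfolding free_family_def
proof (intro allI impI)
  fix y
  assume y: "\<forall>j\<in>insert i J. y j \<in> finite_rank_space A"
  obtain T1 where T1: "T1 \<in> finite_rank_part A"
      "\<And>j. j \<in> J \<Longrightarrow> blinfun_apply T1 (x j) = y j"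
    using free_familyE[OF free, of y] y by blast
  have "y i - blinfun_apply T1 (x i) \<in> finite_rank_space A"
    using y T1(1) by (simp add: subspace_diff subspace_finite_rank_space apply_in_finite_rank_space)
  then obtain R where R: "R \<in> finite_rank_part A"
      "blinfun_apply R (blinfun_apply T0 (x i)) = y i - blinfun_apply T1 (x i)"
    using finite_rank_orbit[OF L T0(3)] by blast
  have "R o\<^sub>L T0 \<in> finite_rank_part A"
    using finite_rank_part_ideal(1)[OF L] R(1) T0(1) finite_rank_part_subset by blast
  then have "T1 + (R o\<^sub>L T0) \<in> finite_rank_part A"
    using T1(1) subspace_finite_rank_part[OF L] by (simp add: subspace_add)
  moreover have "\<forall>j\<in>insert i J. blinfun_apply (T1 + (R o\<^sub>L T0)) (x j) = y j"
    using T0(2,3) T1(2) R(2) by (auto simp: blinfun.add_left)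
  ultimately show "\<exists>T\<in>finite_rank_part A. \<forall>j\<in>insert i J. blinfun_apply T (x j) = y j"
    by blast
qed

text \<open>Under the last hypothesis the value \<open>T z\<close> depends only on the values of \<open>T\<close> at the free
  family, and these values are arbitrary.  So \<open>(T x\<^sub>j)\<^sub>j \<mapsto> T z\<close> is a well-defined module
  homomorphism from a power of \<open>V\<close> to \<open>V\<close>, and its components are the required operators.\<close>

lemma commutant_combination:
  assumes L: "L_algebra A" and fin: "finite J" and free: "free_family A J x"
    and kill: "\<And>T. T \<in> finite_rank_part A \<Longrightarrow> (\<And>j. j \<in> J \<Longrightarrow> blinfun_apply T (x j) = 0)
      \<Longrightarrow> blinfun_apply T z = 0"
  obtains S where "\<And>j. j \<in> J \<Longrightarrow> S j \<in> commuting_operators A"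
    and "\<And>T. T \<in> finite_rank_part A
      \<Longrightarrow> blinfun_apply T z = (\<Sum>j\<in>J. S j (blinfun_apply T (x j)))"
proof -
  let ?F = "finite_rank_part A" and ?V = "finite_rank_space A"
  note F = subspace_finite_rank_part[OF L]
  note V = subspace_finite_rank_space[of A]
  have determined: "blinfun_apply T z = blinfun_apply T' z"
    if "T \<in> ?F" "T' \<in> ?F" "\<And>j. j \<in> J \<Longrightarrow> blinfun_apply T (x j) = blinfun_apply T' (x j)" for T T'
    using kill[of "T - T'"] that F by (simp add: subspace_diff blinfun.diff_left)
  \<comment> \<open>The operators \<open>P j v\<close> realise the \<open>j\<close>-th coordinate embedding of \<open>V\<close> into its power
      \<open>V\<^sup>J\<close>.\<close>
  have "\<exists>T\<in>?F. \<forall>l\<in>J. blinfun_apply T (x l) = (if l = j then v else 0)" if "v \<in> ?V" for j v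
    using free that V unfolding free_family_def by (simp add: subspace_0)
  then have "\<forall>j v. \<exists>T. v \<in> ?V \<longrightarrow>
      T \<in> ?F \<and> (\<forall>l\<in>J. blinfun_apply T (x l) = (if l = j then v else 0))"
    by blast
  then obtain P where "\<forall>j v. v \<in> ?V \<longrightarrow>
      P j v \<in> ?F \<and> (\<forall>l\<in>J. blinfun_apply (P j v) (x l) = (if l = j then v else 0))"
    unfolding choice_iff by blast
  then have P: "\<And>j v. v \<in> ?V \<Longrightarrow> P j v \<in> ?F"
      "\<And>j v l. v \<in> ?V \<Longrightarrow> l \<in> J \<Longrightarrow> blinfun_apply (P j v) (x l) = (if l = j then v else 0)"
    by blast+
  define S where "S j = (\<lambda>v\<in>?V. blinfun_apply (P j v) z)" for j
  have S: "S j v = blinfun_apply T z"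
    if "v \<in> ?V" "T \<in> ?F" "\<And>l. l \<in> J \<Longrightarrow> blinfun_apply T (x l) = (if l = j then v else 0)" for j v T
    using that determined[of "P j v" T] P by (simp add: S_def)
  have "S j \<in> commuting_operators A" for j
    unfolding commuting_operators_def Let_def
  proof (intro CollectI conjI ballI allI)
    show "S j \<in> ?V \<rightarrow>\<^sub>E ?V"
      using P(1) by (auto simp: S_def apply_in_finite_rank_space)
  next
    fix u v assume uv: "u \<in> ?V" "v \<in> ?V"
    have "S j (u + v) = blinfun_apply (P j u + P j v) z"
      using uv P F V by (intro S) (auto simp: subspace_add blinfun.add_left)
    then show "S j (u + v) = S j u + S j v"
      using uv by (simp add: S_def blinfun.add_left)
  next
    fix c v assume v: "v \<in> ?V"
    have "S j (c *\<^sub>R v) = blinfun_apply (c *\<^sub>R P j v) z"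
      using v P F V by (intro S) (auto simp: subspace_scale blinfun.scaleR_left)
    then show "S j (c *\<^sub>R v) = c *\<^sub>R S j v"
      using v by (simp add: S_def blinfun.scaleR_left)
  next
    fix T v assume T: "T \<in> ?F" and v: "v \<in> ?V"
    have "T o\<^sub>L P j v \<in> ?F"
      using finite_rank_part_ideal(1)[OF L] finite_rank_part_subset T P(1)[OF v] by blast
    then have "S j (blinfun_apply T v) = blinfun_apply (T o\<^sub>L P j v) z"
      using T v P by (intro S) (auto simp: apply_in_finite_rank_space)
    then show "S j (blinfun_apply T v) = blinfun_apply T (S j v)"
      using v by (simp add: S_def)
  qed
  moreover have "blinfun_apply T z = (\<Sum>j\<in>J. S j (blinfun_apply T (x j)))" if T: "T \<in> ?F" for T
  proof -
    let ?P = "\<lambda>j. P j (blinfun_apply T (x j))"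
    have TV: "blinfun_apply T (x j) \<in> ?V" for j
      using T by (rule apply_in_finite_rank_space)
    have "blinfun_apply T z = blinfun_apply (\<Sum>j\<in>J. ?P j) z"
    proof (rule determined[OF T])
      show "(\<Sum>j\<in>J. ?P j) \<in> ?F"
        using F P(1) TV by (intro subspace_sum) auto
      show "blinfun_apply T (x l) = blinfun_apply (\<Sum>j\<in>J. ?P j) (x l)" if "l \<in> J" for l
        using that fin P(2)[OF TV that] by (simp add: blinfun.sum_left)
    qed
    then show ?thesis using TV by (simp add: blinfun.sum_left S_def)
  qed
  ultimately show ?thesis using that by blast
qed


section \<open>Counting dimensions\<close>

lemma commuting_operators_iso_sum:
  assumes iso: "commuting_operators_iso f A" and v: "v \<in> finite_rank_space A" and "finite I"
  shows "f (\<Sum>i\<in>I. c i *\<^sub>R a i) v = (\<Sum>i\<in>I. c i *\<^sub>R f (a i) v)"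
proof -
  have add: "f (a + b) v = f a v + f b v" and scale: "f (r *\<^sub>R a) v = r *\<^sub>R f a v" for a b r
    using iso v by (auto simp: commuting_operators_iso_def Let_def)
  have "f 0 v = 0" using scale[of 0 0] by simp
  with \<open>finite I\<close> show ?thesis by induction (simp_all add: add scale)
qed

text \<open>By maximality of \<open>J\<close>, every \<open>T x\<^sub>i\<close> is a combination of the \<open>T x\<^sub>j\<close>, \<open>j \<in> J\<close>, with coefficients
  \<open>f (a i j)\<close> in the commutant.  Expanding \<open>a i j\<close> along \<open>B\<close> turns the existence of a real
  combination of the \<open>x\<^sub>i\<close> that is killed by all of \<open>F\<close> into a system of \<open>card J * card B\<close> real
  equations in \<open>m\<close> unknowns.\<close>

lemma large_free_subfamily:
  fixes f :: "'k::real_algebra_1 \<Rightarrow> 'a \<Rightarrow> 'a::real_normed_vector"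
  assumes L: "L_algebra A" and iso: "commuting_operators_iso f A"
    and B: "finite B" "span B = (UNIV :: 'k set)"
    and indep: "independent_family m x"
  obtains J where "J \<subseteq> {1..m}" "free_family A J x" "m \<le> card B * card J"
proof -
  let ?F = "finite_rank_part A"
  let ?free = "\<lambda>J. J \<subseteq> {1..m} \<and> free_family A J x"
  have "?free {}"
    using subspace_0[OF subspace_finite_rank_part[OF L]] by (auto simp: free_family_def)
  moreover have "\<forall>J. ?free J \<longrightarrow> card J < Suc m"
    using card_mono[of "{1..m}"] by (auto simp: less_Suc_eq_le)
  ultimately obtain J where J: "?free J" and max: "\<And>J'. ?free J' \<Longrightarrow> card J' \<le> card J"
    using ex_has_greatest_nat[of ?free "{}" card "Suc m"] by blast
  have finJ: "finite J" using J finite_subset by blast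
  \<comment> \<open>An operator violating this would show that \<open>i\<close> lies outside \<open>J\<close> and can be added to it.\<close>
  have kill: "blinfun_apply T (x i) = 0"
    if i: "i \<in> {1..m}" and T: "T \<in> ?F" "\<And>j. j \<in> J \<Longrightarrow> blinfun_apply T (x j) = 0" for i T
  proof (rule ccontr)
    assume nz: "blinfun_apply T (x i) \<noteq> 0"
    then have "i \<notin> J" using T(2) by blast
    moreover have "free_family A (insert i J) x"
      using free_family_insert[where x = x and i = i, OF L _ T nz] J by blast
    ultimately show False
      using max[of "insert i J"] J i finJ by simp
  qed
  have "\<exists>a. \<forall>T\<in>?F. blinfun_apply T (x i) = (\<Sum>j\<in>J. f (a j) (blinfun_apply T (x j)))"
    if i: "i \<in> {1..m}" for i
  proof -
    obtain S where S: "\<And>j. j \<in> J \<Longrightarrow> S j \<in> commuting_operators A"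
      "\<And>T. T \<in> ?F \<Longrightarrow> blinfun_apply T (x i) = (\<Sum>j\<in>J. S j (blinfun_apply T (x j)))"
      using commutant_combination[OF L finJ _ kill[OF i]] J by blast
    have "commuting_operators A = range f"
      using iso by (simp add: commuting_operators_iso_def Let_def bij_betw_def)
    then have "\<forall>j\<in>J. \<exists>b. S j = f b" using S(1) by blast
    then obtain a where "\<forall>j\<in>J. S j = f (a j)" by metis
    then show ?thesis using S(2) by (intro exI[of _ a]) simp
  qed
  then obtain a where a: "\<And>i T. i \<in> {1..m} \<Longrightarrow> T \<in> ?F
      \<Longrightarrow> blinfun_apply T (x i) = (\<Sum>j\<in>J. f (a i j) (blinfun_apply T (x j)))"
    by metis
  have "m \<le> card B * card J"
  proof (rule ccontr)
    assume "\<not> m \<le> card B * card J"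
    then have less: "card (J \<times> B) < card {1..m}"
      by (simp add: card_cartesian_product mult.commute)
    have "\<exists>q. a i j = (\<Sum>b\<in>B. q b *\<^sub>R b)" for i j
      using B span_finite[OF B(1)] by (metis (no_types, lifting) UNIV_I image_iff)
    then obtain q where q: "\<And>i j. a i j = (\<Sum>b\<in>B. q i j b *\<^sub>R b)" by metis
    obtain c where c: "\<exists>i\<in>{1..m}. c i \<noteq> 0"
      and sol: "\<forall>e\<in>J \<times> B. (\<Sum>i\<in>{1..m}. c i * q i (fst e) (snd e)) = 0"
      using nontrivial_solution_homogeneous_system[OF _ _ less,
          of "\<lambda>i e. q i (fst e) (snd e)"] finJ B(1) by auto
    have coeff: "(\<Sum>i\<in>{1..m}. c i *\<^sub>R a i j) = 0" if j: "j \<in> J" for j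
    proof -
      have "(\<Sum>i\<in>{1..m}. c i *\<^sub>R a i j) = (\<Sum>i\<in>{1..m}. \<Sum>b\<in>B. (c i * q i j b) *\<^sub>R b)"
        by (simp add: q scaleR_sum_right)
      also have "\<dots> = (\<Sum>b\<in>B. (\<Sum>i\<in>{1..m}. c i * q i j b) *\<^sub>R b)"
        by (subst sum.swap) (simp add: scaleR_sum_left)
      also have "\<dots> = 0" using sol j by (intro sum.neutral) auto
      finally show ?thesis .
    qed
    let ?z = "\<Sum>i\<in>{1..m}. c i *\<^sub>R x i"
    have Tz: "blinfun_apply T ?z = 0" if T: "T \<in> ?F" for T
    proof -
      have TV: "blinfun_apply T (x j) \<in> finite_rank_space A" for j
        using T by (rule apply_in_finite_rank_space)
      have "blinfun_apply T ?z
          = (\<Sum>i\<in>{1..m}. c i *\<^sub>R (\<Sum>j\<in>J. f (a i j) (blinfun_apply T (x j))))"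
        using a T by (simp add: blinfun.sum_right blinfun.scaleR_right)
      also have "\<dots> = (\<Sum>j\<in>J. \<Sum>i\<in>{1..m}. c i *\<^sub>R f (a i j) (blinfun_apply T (x j)))"
        by (subst sum.swap) (simp add: scaleR_sum_right)
      also have "\<dots> = (\<Sum>j\<in>J. f (\<Sum>i\<in>{1..m}. c i *\<^sub>R a i j) (blinfun_apply T (x j)))"
        using commuting_operators_iso_sum[OF iso TV, of "{1..m}"] by simp
      also have "\<dots> = (\<Sum>j\<in>J. f 0 (blinfun_apply T (x j)))"
        using coeff by simp
      also have "\<dots> = 0"
        using commuting_operators_iso_sum[OF iso TV, of "{}"] by simp
      finally show ?thesis .
    qed
    have "?z = 0"
    proof (rule ccontr)
      assume "?z \<noteq> 0"
      moreover obtain v where "v \<in> finite_rank_space A" "v \<noteq> 0"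
        using finite_rank_space_nonzero[OF L] .
      ultimately show False
        using finite_rank_orbit[OF L] Tz by metis
    qed
    then show False
      using independent_family_coeff_zero[OF indep] c by blast
  qed
  then show ?thesis using that J by blast
qed


section \<open>Density\<close>

lemma free_family_approx:
  assumes L: "L_algebra A" and free: "free_family A J x" and "\<epsilon> > 0"
  obtains T where "T \<in> A" "\<And>j. j \<in> J \<Longrightarrow> norm (blinfun_apply T (x j) - y j) < \<epsilon>"
proof -
  have "\<forall>j. \<exists>v. v \<in> finite_rank_space A \<and> norm (v - y j) < \<epsilon>"
    using finite_rank_space_approx[OF L \<open>\<epsilon> > 0\<close>] by blast
  then obtain v where v: "\<And>j. v j \<in> finite_rank_space A" "\<And>j. norm (v j - y j) < \<epsilon>"
    by metis
  obtain T where "T \<in> finite_rank_part A" "\<And>j. j \<in> J \<Longrightarrow> blinfun_apply T (x j) = v j"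
    using free_familyE[OF free, of v] v(1) by blast
  then show ?thesis using that v(2) finite_rank_part_subset by (metis subsetD)
qed

lemma commutant_one_dimensional_imp_dense:
  assumes L: "L_algebra A" and iso: "commuting_operators_iso (f :: real \<Rightarrow> 'a \<Rightarrow> 'a) A"
  shows "dense_algebra (A :: ('a::real_normed_vector \<Rightarrow>\<^sub>L 'a) set)"
  unfolding dense_algebra_def
proof (intro allI impI)
  fix \<epsilon> :: real and n and x y :: "nat \<Rightarrow> 'a"
  assume \<epsilon>: "\<epsilon> > 0" and indep: "independent_family n x"
  have "r \<in> span {1}" for r :: real
    using span_scale[OF span_base[of "1::real" "{1}"], of r] by simp
  then have "span {1} = (UNIV :: real set)" by blast
  then obtain J where J: "J \<subseteq> {1..n}" "free_family A J x" "n \<le> card J"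
    using large_free_subfamily[OF L iso _ _ indep, of "{1}"] by auto
  then have "J = {1..n}" by (intro card_seteq) auto
  then show "\<exists>T\<in>A. \<forall>i\<in>{1..n}. norm (blinfun_apply T (x i) - y i) < \<epsilon>"
    using free_family_approx[OF L J(2) \<epsilon>] by metis
qed

lemma commutant_finite_dimensional_imp_fraction_dense:
  fixes f :: "'k::real_algebra_1 \<Rightarrow> 'a \<Rightarrow> 'a::real_normed_vector"
  assumes L: "L_algebra A" and iso: "commuting_operators_iso f A"
    and B: "finite B" "span B = (UNIV :: 'k set)" "card B \<le> k" and k: "k > 0"
  shows "fraction_dense k A"
  unfolding fraction_dense_def
proof (intro allI impI)
  fix \<epsilon> :: real and n and x y :: "nat \<Rightarrow> 'a"
  assume \<epsilon>: "\<epsilon> > 0" and indep: "independent_family (k * n) x"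
  obtain J where J: "J \<subseteq> {1..k * n}" "free_family A J x" "k * n \<le> card B * card J"
    using large_free_subfamily[OF L iso B(1,2) indep] .
  have "k * n \<le> k * card J"
    using J(3) B(3) by (meson le_trans mult_le_mono1)
  then have "card {1..n} \<le> card J" using k by simp
  moreover have "finite J" using J(1) finite_subset by blast
  ultimately obtain j where j: "inj_on j {1..n}" "j ` {1..n} \<subseteq> J"
    using card_le_inj[of "{1..n}" J] by auto
  \<comment> \<open>Targets have to be prescribed on all of \<open>J\<close>, which may have more than \<open>n\<close> elements; off the
      range of \<open>j\<close> the inverse returns an arbitrary index.\<close>
  obtain T where T: "T \<in> A"
    "\<And>l. l \<in> J \<Longrightarrow> norm (blinfun_apply T (x l) - y (the_inv_into {1..n} j l)) < \<epsilon>"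
    using free_family_approx[OF L J(2) \<epsilon>, of "\<lambda>l. y (the_inv_into {1..n} j l)"] by blast
  have "norm (y i - blinfun_apply T (x (j i))) < \<epsilon>" if "i \<in> {1..n}" for i
  proof -
    have "j i \<in> J" using j(2) that by blast
    then show ?thesis
      using T(2)[of "j i"] the_inv_into_f_f[OF j(1) that] by (simp add: norm_minus_commute)
  qed
  then show "\<exists>j. (\<forall>i\<in>{1..n}. j i \<in> {1..k * n}) \<and>
      (\<exists>T\<in>A. \<forall>i\<in>{1..n}. norm (y i - blinfun_apply T (x (j i))) < \<epsilon>)"
    using j(2) J(1) T(1) by (intro exI[of _ j]) blast
qed

lemma span_complex_units: "span {1, \<i>} = (UNIV :: complex set)"
proof -
  have "z \<in> span {1, \<i>}" for z
  proof -
    have "z = Re z *\<^sub>R 1 + Im z *\<^sub>R \<i>" by (simp add: complex_eq_iff)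
    also have "\<dots> \<in> span {1, \<i>}"
      by (intro span_add span_scale span_base) auto
    finally show ?thesis .
  qed
  then show ?thesis by blast
qed

lemma span_quat_units:
  "span {Quat 1 0 0 0, Quat 0 1 0 0, Quat 0 0 1 0, Quat 0 0 0 1} = UNIV" (is "span ?B = _")
proof -
  have "p \<in> span ?B" for p
  proof -
    have "p = qre p *\<^sub>R Quat 1 0 0 0 + qi p *\<^sub>R Quat 0 1 0 0
        + qj p *\<^sub>R Quat 0 0 1 0 + qk p *\<^sub>R Quat 0 0 0 1"
      by (simp add: quat_eq_iff plus_quat_def scaleR_quat_def)
    also have "\<dots> \<in> span ?B"
      by (intro span_add span_scale span_base) auto
    finally show ?thesis .
  qed
  then show ?thesis by blast
qed

theorem theorem2p10:
  fixes A :: "('a::banach \<Rightarrow>\<^sub>L 'a) set"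
  assumes infinite_dimensional: "\<not> (\<exists>B :: 'a set. finite B \<and> span B = UNIV)"
    and L_algebra: "L_algebra A"
  shows "(real_type A \<longrightarrow> dense_algebra A) \<and>
         (complex_type A \<longrightarrow> fraction_dense 2 A) \<and>
         (quaternion_type A \<longrightarrow> fraction_dense 4 A)"
proof (intro conjI impI)
  assume "real_type A"
  then show "dense_algebra A"
    unfolding real_type_def
    using commutant_one_dimensional_imp_dense[OF L_algebra] by blast
next
  assume "complex_type A"
  then obtain f :: "complex \<Rightarrow> 'a \<Rightarrow> 'a" where "commuting_operators_iso f A"
    unfolding complex_type_def by blast
  then show "fraction_dense 2 A"
    by (rule commutant_finite_dimensional_imp_fraction_dense[OF L_algebra _ _ span_complex_units])
      (auto simp: card_insert_if)
next
  assume "quaternion_type A"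
  then obtain f :: "quat \<Rightarrow> 'a \<Rightarrow> 'a" where "commuting_operators_iso f A"
    unfolding quaternion_type_def by blast
  then show "fraction_dense 4 A"
    by (rule commutant_finite_dimensional_imp_fraction_dense[OF L_algebra _ _ span_quat_units])
      (auto simp: card_insert_if)
qed

end
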